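(* Let $A,B,C,D$ be four distinct points lying, in this order, on a circle $\Omega$ with center $O$, and assume that none of the triangles $ABC$, $ABD$, $ACD$, $BCD$ is equilateral. Denote by $H_D,H_B,H_C,H_A$ the orthocenters of $\triangle ABC$, $\triangle ACD$, $\triangle ABD$, $\triangle BCD$, respectively. Let $P_D$ be any point on the Euler line $OH_D$ of $\triangle ABC$. Let $P_A$ be the point on the Euler line $OH_A$ of $\triangle BCD$ such that $$\frac{P_AH_A}{P_AO}=\frac{P_DH_D}{P_DO},$$ and define $P_B$ on the Euler line $OH_B$ of $\triangle ACD$ and $P_C$ on the Euler line $OH_C$ of $\triangle ABD$ similarly, i.e. by $\frac{P_BH_B}{P_BO}=\frac{P_DH_D}{P_DO}$ and $\frac{P_CH_C}{P_CO}=\frac{P_DH_D}{P_DO}$. Let $Q_D$ be the isogonal conjugate of $P_D$ with respect to $\triangle ABC$, and let $Q_A,Q_B,Q_C$ be the isogonal conjugates of $P_A,P_B,P_C$ with respect to $\triangle BCD$, $\triangle ACD$, $\triangle ABD$, respectively. Then the eight points $$A,\;B,\;C,\;D,\;Q_A,\;Q_B,\;Q_C,\;Q_D$$ all lie on a single conic.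
   Context: We work in the real projective plane obtained from the Euclidean plane by adding the line at infinity. A conic is the zero set of a nonzero homogeneous quadratic form in three variables (it may be degenerate, e.g. a pair of lines). The Euler line of a non-equilateral triangle is the line through its circumcenter and orthocenter; all four triangles here have circumcenter $O$. The ratios $\frac{P_XH_X}{P_XO}$ are signed ratios of collinear segments with values in $\mathbb{R}\cup\{\infty\}$: the value is $\infty$ when $P_X=O$ and $1$ when $P_X$ is the point at infinity of the line $OH_X$. The isogonal conjugate of a point $P$ with respect to a triangle is the common point of the reflections of the lines joining $P$ to the vertices in the corresponding internal angle bisectors. In homogeneous barycentric coordinates with respect to a triangle with side lengths $a,b,c$, the conjugate of $(x:y:z)$ is $(a^2yz:b^2zx:c^2xy)$. It is defined for every $P$ other than the vertices; the isogonal conjugates appearing in the statement are understood to be defined. *)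

theory Defs
  imports "HOL-Analysis.Analysis"
begin

section \<open>The real projective plane\<close>

text \<open>
  Homogeneous coordinates are nonzero vectors of \<open>real^3\<close> up to scaling.  The Euclidean plane
  \<open>real^2\<close> is embedded by \<open>(x, y) \<mapsto> (x : y : 1)\<close>; the line at infinity is \<open>x $ 3 = 0\<close>.
\<close>

definition proj_eq :: "real^3 \<Rightarrow> real^3 \<Rightarrow> bool" where
  "proj_eq x y \<longleftrightarrow> x \<noteq> 0 \<and> y \<noteq> 0 \<and> (\<exists>k. y = k *\<^sub>R x)"

lemma proj_eq_part_equivp: "part_equivp proj_eq"
proof (rule part_equivpI)
  have "(vector [0, 0, 1] :: real^3) \<noteq> 0"
    by (auto simp: vec_eq_iff forall_3 vector_3)
  then have "proj_eq (vector [0, 0, 1]) (vector [0, 0, 1])"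
    unfolding proj_eq_def by (auto intro: exI[of _ 1])
  then show "\<exists>x. proj_eq x x" by blast
next
  show "symp proj_eq"
  proof (rule sympI)
    fix x y assume "proj_eq x y"
    then obtain k where k: "x \<noteq> 0" "y \<noteq> 0" "y = k *\<^sub>R x"
      unfolding proj_eq_def by blast
    then have "x = inverse k *\<^sub>R y" by auto
    with k show "proj_eq y x" unfolding proj_eq_def by blast
  qed
next
  show "transp proj_eq"
    by (rule transpI) (auto simp: proj_eq_def)
qed

quotient_type projplane = "real^3" / partial: proj_eq
  by (rule proj_eq_part_equivp)

definition homog :: "real^2 \<Rightarrow> real \<Rightarrow> real^3" where
  "homog v w = vector [v $ 1, v $ 2, w]"

definition xy_part :: "real^3 \<Rightarrow> real^2" where
  "xy_part x = vector [x $ 1, x $ 2]"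

lemma homog_nth [simp]:
  "homog v w $ 1 = v $ 1" "homog v w $ 2 = v $ 2" "homog v w $ 3 = w"
  by (simp_all add: homog_def vector_3)

lemma xy_part_nth [simp]: "xy_part x $ 1 = x $ 1" "xy_part x $ 2 = x $ 2"
  by (simp_all add: xy_part_def vector_2)

lemma homog_eq_0_iff: "homog v w = 0 \<longleftrightarrow> v = 0 \<and> w = 0"
  by (auto simp: vec_eq_iff forall_2 forall_3)

lemma homog_scaleR: "homog (k *\<^sub>R v) (k * w) = k *\<^sub>R homog v w"
  by (simp add: vec_eq_iff forall_3)

lemma homog_xy_part: "homog (xy_part x) (x $ 3) = x"
  by (simp add: vec_eq_iff forall_3)

lemma xy_part_homog [simp]: "xy_part (homog v w) = v"
  by (simp add: vec_eq_iff forall_2)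

lemma xy_part_scaleR [simp]: "xy_part (k *\<^sub>R x) = k *\<^sub>R xy_part x"
  by (simp add: vec_eq_iff forall_2)

lift_definition affine_pt :: "real^2 \<Rightarrow> projplane" is "\<lambda>p. homog p 1"
  by (auto simp: proj_eq_def homog_eq_0_iff intro: exI[of _ 1])

lift_definition at_infinity :: "projplane \<Rightarrow> bool" is "\<lambda>x. x $ 3 = 0"
  by (auto simp: proj_eq_def)

text \<open>Incidence with the line whose equation has coefficient vector \<open>l\<close> (a line if \<open>l \<noteq> 0\<close>).\<close>

lift_definition incident :: "real^3 \<Rightarrow> projplane \<Rightarrow> bool" is "\<lambda>l x. l \<bullet> x = 0"
  by (auto simp: proj_eq_def)

definition is_line :: "projplane set \<Rightarrow> bool" where
  "is_line L \<longleftrightarrow> (\<exists>l. l \<noteq> 0 \<and> L = {X. incident l X})"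

text \<open>For \<open>X \<noteq> Y\<close> exactly one line contains both, and \<open>proj_join X Y\<close> is that line.\<close>

definition proj_join :: "projplane \<Rightarrow> projplane \<Rightarrow> projplane set" where
  "proj_join X Y = \<Union> {L. is_line L \<and> X \<in> L \<and> Y \<in> L}"

lift_definition quadratic_zero ::
    "real \<Rightarrow> real \<Rightarrow> real \<Rightarrow> real \<Rightarrow> real \<Rightarrow> real \<Rightarrow> projplane \<Rightarrow> bool" is
  "\<lambda>a b c d e f x. a * (x $ 1)\<^sup>2 + b * (x $ 2)\<^sup>2 + c * (x $ 3)\<^sup>2
     + d * (x $ 1) * (x $ 2) + e * (x $ 1) * (x $ 3) + f * (x $ 2) * (x $ 3) = 0"
proof -
  fix a b c d e f :: real and x y :: "real^3"
  assume "proj_eq x y"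
  then obtain k where k: "y \<noteq> 0" "y = k *\<^sub>R x" by (auto simp: proj_eq_def)
  let ?q = "\<lambda>x :: real^3. a * (x $ 1)\<^sup>2 + b * (x $ 2)\<^sup>2 + c * (x $ 3)\<^sup>2
     + d * (x $ 1) * (x $ 2) + e * (x $ 1) * (x $ 3) + f * (x $ 2) * (x $ 3)"
  have "?q y = k\<^sup>2 * ?q x" unfolding k(2) by (simp add: power2_eq_square algebra_simps)
  moreover have "k \<noteq> 0" using k by auto
  ultimately show "(?q x = 0) = (?q y = 0)" by simp
qed

definition is_conic :: "projplane set \<Rightarrow> bool" where
  "is_conic S \<longleftrightarrow> (\<exists>a b c d e f. (a, b, c, d, e, f) \<noteq> (0, 0, 0, 0, 0, 0)
     \<and> S = {X. quadratic_zero a b c d e f X})"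


section \<open>Triangles and points on a circle\<close>

text \<open>The points occur in the given cyclic order, in the positive or in the negative sense.\<close>

definition on_circle_in_order ::
    "real^2 \<Rightarrow> real \<Rightarrow> real^2 \<Rightarrow> real^2 \<Rightarrow> real^2 \<Rightarrow> real^2 \<Rightarrow> bool" where
  "on_circle_in_order z r A B C D \<longleftrightarrow>
     (\<exists>\<alpha> \<beta> \<gamma> \<delta>.
        (\<alpha> < \<beta> \<and> \<beta> < \<gamma> \<and> \<gamma> < \<delta> \<and> \<delta> < \<alpha> + 2 * pi \<or>
         \<alpha> > \<beta> \<and> \<beta> > \<gamma> \<and> \<gamma> > \<delta> \<and> \<delta> > \<alpha> - 2 * pi) \<and>
        A = z + r *\<^sub>R vector [cos \<alpha>, sin \<alpha>] \<and> B = z + r *\<^sub>R vector [cos \<beta>, sin \<beta>] \<and>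
        C = z + r *\<^sub>R vector [cos \<gamma>, sin \<gamma>] \<and> D = z + r *\<^sub>R vector [cos \<delta>, sin \<delta>])"

definition equilateral :: "real^2 \<Rightarrow> real^2 \<Rightarrow> real^2 \<Rightarrow> bool" where
  "equilateral A B C \<longleftrightarrow> dist A B = dist B C \<and> dist B C = dist C A"

definition is_orthocenter :: "real^2 \<Rightarrow> real^2 \<Rightarrow> real^2 \<Rightarrow> real^2 \<Rightarrow> bool" where
  "is_orthocenter A B C H \<longleftrightarrow>
     (H - A) \<bullet> (B - C) = 0 \<and> (H - B) \<bullet> (C - A) = 0 \<and> (H - C) \<bullet> (A - B) = 0"

text \<open>
  The signed ratio \<open>PH / PZ\<close> for \<open>P\<close> on the line \<open>ZH\<close> (\<open>Z \<noteq> H\<close>), with values in the reals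
  and \<open>\<infinity>\<close>; the value \<open>-\<infinity>\<close> of \<open>ereal\<close> is not used.
\<close>

definition signed_ratio :: "projplane \<Rightarrow> real^2 \<Rightarrow> real^2 \<Rightarrow> ereal" where
  "signed_ratio P H Z =
     (if P = affine_pt Z then \<infinity>
      else if at_infinity P then 1
      else ereal (THE t. \<exists>p. P = affine_pt p \<and> H - p = t *\<^sub>R (Z - p)))"


section \<open>Isogonal conjugation\<close>

text \<open>Euclidean reflection in the line through \<open>a\<close> with direction \<open>u \<noteq> 0\<close>.\<close>

definition line_reflection :: "real^2 \<Rightarrow> real^2 \<Rightarrow> real^2 \<Rightarrow> real^2" where
  "line_reflection a u p = a + (2 * ((p - a) \<bullet> u) / (u \<bullet> u)) *\<^sub>R u - (p - a)"

lemma reflected_vector_eq_0: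
  fixes u v :: "real^2"
  assumes "(2 * (v \<bullet> u) / (u \<bullet> u)) *\<^sub>R u - v = 0"
  shows "v = 0"
proof -
  define s where "s = 2 * (v \<bullet> u) / (u \<bullet> u)"
  have v: "v = s *\<^sub>R u" using assms by (simp add: s_def)
  have "s = 2 * s \<or> u = 0"
  proof (cases "u = 0")
    case False
    have "v \<bullet> u = s * (u \<bullet> u)" by (subst v) simp
    with False show ?thesis by (simp add: s_def)
  qed simp
  then show ?thesis using v by auto
qed

text \<open>
  The extension of this reflection to the projective plane: the point \<open>(p : 1)\<close> goes to
  \<open>(line_reflection a u p : 1)\<close>, and the point at infinity of direction \<open>v\<close> goes to that of the
  mirror image of \<open>v\<close>.
\<close>

lift_definition proj_reflection :: "real^2 \<Rightarrow> real^2 \<Rightarrow> projplane \<Rightarrow> projplane" is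
  "\<lambda>a u x. let w = x $ 3; v = xy_part x - w *\<^sub>R a
     in homog (w *\<^sub>R a + (2 * (v \<bullet> u) / (u \<bullet> u)) *\<^sub>R u - v) w"
proof -
  fix a u :: "real^2" and x y :: "real^3"
  let ?v = "\<lambda>x :: real^3. xy_part x - (x $ 3) *\<^sub>R a"
  let ?f = "\<lambda>x. homog ((x $ 3) *\<^sub>R a + (2 * (?v x \<bullet> u) / (u \<bullet> u)) *\<^sub>R u - ?v x) (x $ 3)"
  assume "proj_eq x y"
  then obtain k where k: "x \<noteq> 0" "y \<noteq> 0" "y = k *\<^sub>R x" by (auto simp: proj_eq_def)
  have nz: "?f z \<noteq> 0" if "z \<noteq> 0" for z :: "real^3"
  proof
    assume 0: "?f z = 0"
    then have w: "z $ 3 = 0" by (simp only: homog_eq_0_iff)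
    have "(z $ 3) *\<^sub>R a + (2 * (?v z \<bullet> u) / (u \<bullet> u)) *\<^sub>R u - ?v z = 0"
      using 0 unfolding homog_eq_0_iff by (rule conjunct1)
    then have "(2 * (?v z \<bullet> u) / (u \<bullet> u)) *\<^sub>R u - ?v z = 0"
      by (simp only: w scaleR_zero_left add_0_left)
    then have "?v z = 0" by (rule reflected_vector_eq_0)
    then have "xy_part z = 0" by (simp only: w scaleR_zero_left diff_zero)
    with w have "homog (xy_part z) (z $ 3) = 0" by (simp add: homog_eq_0_iff)
    with that show False by (simp add: homog_xy_part)
  qed
  have v: "?v y = k *\<^sub>R ?v x" by (simp add: k(3) scaleR_diff_right)
  have w: "y $ 3 = k * x $ 3" by (simp add: k(3))
  have gen: "homog ((k * c) *\<^sub>R a + (2 * ((k *\<^sub>R p) \<bullet> u) / (u \<bullet> u)) *\<^sub>R u - k *\<^sub>R p) (k * c)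
      = k *\<^sub>R homog (c *\<^sub>R a + (2 * (p \<bullet> u) / (u \<bullet> u)) *\<^sub>R u - p) c" for c p
    unfolding homog_scaleR[symmetric]
    by (simp add: scaleR_diff_right scaleR_add_right mult.left_commute)
  have "?f y = k *\<^sub>R ?f x" unfolding v unfolding w by (rule gen)
  with nz k have "proj_eq (?f x) (?f y)" unfolding proj_eq_def by blast
  then show "proj_eq
      (let w = x $ 3; v = xy_part x - w *\<^sub>R a
       in homog (w *\<^sub>R a + (2 * (v \<bullet> u) / (u \<bullet> u)) *\<^sub>R u - v) w)
      (let w = y $ 3; v = xy_part y - w *\<^sub>R a
       in homog (w *\<^sub>R a + (2 * (v \<bullet> u) / (u \<bullet> u)) *\<^sub>R u - v) w)"
    by (simp add: Let_def)
qed

lemma proj_reflection_affine_pt: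
  "proj_reflection a u (affine_pt p) = affine_pt (line_reflection a u p)"
  by transfer (auto simp: proj_eq_def homog_eq_0_iff line_reflection_def Let_def intro: exI[of _ 1])

text \<open>
  The direction of the internal bisector of the angle at \<open>A\<close> is the sum of the unit vectors along
  \<open>AB\<close> and \<open>AC\<close>.
\<close>

definition reflect_in_bisector :: "real^2 \<Rightarrow> real^2 \<Rightarrow> real^2 \<Rightarrow> projplane \<Rightarrow> projplane" where
  "reflect_in_bisector A B C = proj_reflection A (sgn (B - A) + sgn (C - A))"

text \<open>
  \<open>Q\<close> is the isogonal conjugate of \<open>P\<close> with respect to the triangle \<open>ABC\<close>.  The conjugate is
  undefined for the vertices, so the relation excludes them.
\<close>

definition isogonal_conjugate ::
    "real^2 \<Rightarrow> real^2 \<Rightarrow> real^2 \<Rightarrow> projplane \<Rightarrow> projplane \<Rightarrow> bool" where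
  "isogonal_conjugate A B C P Q \<longleftrightarrow>
     P \<notin> {affine_pt A, affine_pt B, affine_pt C} \<and>
     Q \<in> reflect_in_bisector A B C ` proj_join (affine_pt A) P \<and>
     Q \<in> reflect_in_bisector B C A ` proj_join (affine_pt B) P \<and>
     Q \<in> reflect_in_bisector C A B ` proj_join (affine_pt C) P"

end

(*
Take O as origin and the circle as unit circle of the complex plane, write q' for the conjugate
of q, and let s1, s2, s3 be the elementary symmetric functions of a, b, c.  Points p, q are
isogonal conjugates for abc iff p + q + s3 p' q' = s1.  The orthocenter is s1, so a point of the
Euler line is (l s1 : m) with real l, m, the ratio of the statement determines (l : m), and its
conjugate (q : w) satisfies  m q + l s2 q' = (m - l) s1 w.  A combination of this equation with
its complex conjugate is
  m (q^2 + e4 q'^2 - e1 q w - e3 q' w + e2 w^2) + l e2 (q q' - w^2) = 0,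
where e1, ..., e4 are the elementary symmetric functions of a, b, c, d.  It is symmetric in the
four points, is satisfied by them, and its real or imaginary part is the required conic.
For m = 0 it degenerates when e2 = 0; then the conjugates of the points at infinity lie on the circle.
*)

theory Submission
  imports Defs
begin

section \<open>Complex coordinates and nonzero representatives\<close>

definition cplx :: "real^2 \<Rightarrow> complex" where
  "cplx v = Complex (v $ 1) (v $ 2)"

text \<open>
  Moving \<open>Z\<close> to the origin and scaling the circle to the unit circle gives homogeneous coordinates
  \<open>(ctr_coord Z r x : x $ 3)\<close> in the complex plane with a real last entry.
\<close>

definition ctr_coord :: "real^2 \<Rightarrow> real \<Rightarrow> real^3 \<Rightarrow> complex" where
  "ctr_coord Z r x = cplx (xy_part x - x $ 3 *\<^sub>R Z) / of_real r"

lemma cplx_simps [simp]: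
  "cplx (v + w) = cplx v + cplx w" "cplx (v - w) = cplx v - cplx w"
  "cplx (k *\<^sub>R v) = of_real k * cplx v" "cplx (- v) = - cplx v" "cplx 0 = 0"
  by (simp_all add: cplx_def complex_eq_iff)

lemma cplx_eq_iff: "cplx v = cplx w \<longleftrightarrow> v = w"
  by (auto simp: cplx_def vec_eq_iff forall_2)

lemma norm_cplx: "cmod (cplx v) = norm v"
  by (simp add: cplx_def cmod_def norm_vec_def L2_set_def UNIV_2)

lemma inner_cplx: "v \<bullet> w = Re (cplx v * cnj (cplx w))"
  by (simp add: cplx_def inner_vec_def UNIV_2)

lemma ctr_coord_affine [simp]: "ctr_coord Z r (homog p 1) = cplx (p - Z) / of_real r"
  by (simp add: ctr_coord_def)

lemma ctr_coord_scaleR [simp]: "ctr_coord Z r (k *\<^sub>R x) = of_real k * ctr_coord Z r x"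
  by (simp add: ctr_coord_def right_diff_distrib)

lemma ctr_coord_eq_0_iff:
  assumes "r \<noteq> 0" shows "ctr_coord Z r x = 0 \<and> x $ 3 = 0 \<longleftrightarrow> x = 0"
  using assms by (auto simp: ctr_coord_def cplx_def vec_eq_iff forall_3 complex_eq_iff)

text \<open>Reflections in bisectors are computed with the vertex \<open>A\<close> as origin,
  equations on the circle with its center \<open>Z\<close> as origin; this passes between the
  two.\<close>

lemma ctr_coord_shift:
  assumes "r \<noteq> 0"
  shows "ctr_coord A 1 x = of_real r * (ctr_coord Z r x - of_real (x $ 3) * (cplx (A - Z) / of_real r))"
  using assms by (simp add: ctr_coord_def field_simps)

lemma projplane_cases:
  obtains x where "x \<noteq> 0" "X = abs_projplane x"
  by (rule projplane.abs_induct[of "\<lambda>X. (\<exists>x. x \<noteq> 0 \<and> X = abs_projplane x)" X, THEN exE])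
    (auto simp: proj_eq_def)

lemma proj_eq_self: "x \<noteq> 0 \<Longrightarrow> proj_eq x x"
  by (auto simp: proj_eq_def intro: exI[of _ 1])

lemma abs_projplane_eq_iff:
  assumes "x \<noteq> 0" "y \<noteq> 0"
  shows "abs_projplane x = abs_projplane y \<longleftrightarrow> (\<exists>k. y = k *\<^sub>R x)"
  using Quotient_rel[OF Quotient_projplane, of x y] proj_eq_self[OF assms(1)] proj_eq_self[OF assms(2)]
    assms
  by (auto simp: proj_eq_def)

lemma homog_1_nonzero [simp]: "homog p 1 \<noteq> 0"
  by (simp add: homog_eq_0_iff)

section \<open>Lines through a vertex and their reflection in the bisector\<close>

text \<open>With \<open>A\<close> as origin, the normal of a common line is orthogonal to the
  vectors of both points, finite or infinite. Hence these vectors are parallel, which is what the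
  vanishing imaginary part expresses.\<close>

lemma proj_join_parallel:
  assumes nz: "x \<noteq> 0" "z \<noteq> 0"
    and mem: "abs_projplane x \<in> proj_join (affine_pt A) (abs_projplane z)"
  shows "Im (ctr_coord A 1 x * cnj (ctr_coord A 1 z)) = 0"
proof -
  obtain l where l: "l \<noteq> 0" "incident l (affine_pt A)" "incident l (abs_projplane x)"
      "incident l (abs_projplane z)"
    using mem unfolding proj_join_def is_line_def by blast
  have A: "l $ 3 = - (l $ 1 * A $ 1 + l $ 2 * A $ 2)"
    using l(2) by (simp add: affine_pt.abs_eq incident.abs_eq proj_eq_self inner_vec_def sum_3)
  have *: "l $ 1 * (y $ 1 - y $ 3 * A $ 1) + l $ 2 * (y $ 2 - y $ 3 * A $ 2) = 0"
    if "incident l (abs_projplane y)" "y \<noteq> 0" for y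
    using that by (simp add: incident.abs_eq proj_eq_self inner_vec_def sum_3 A algebra_simps)
  \<comment> \<open>A line through a finite point is not the line at infinity.\<close>
  have nl: "l $ 1 \<noteq> 0 \<or> l $ 2 \<noteq> 0"
  proof (rule ccontr)
    assume "\<not> ?thesis"
    with A have "l = 0" by (simp add: vec_eq_iff forall_3)
    with l(1) show False by contradiction
  qed
  have det: "a * d - b * c = 0"
    if h: "m * a + n * b = 0" "m * c + n * d = 0" and mn: "m \<noteq> 0 \<or> n \<noteq> 0"
    for a b c d m n :: real
  proof -
    have "m * (a * d - b * c) = d * (m * a + n * b) - b * (m * c + n * d)"
         "n * (a * d - b * c) = a * (m * c + n * d) - c * (m * a + n * b)"
      by (simp_all add: algebra_simps)
    then have "m * (a * d - b * c) = 0" "n * (a * d - b * c) = 0"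
      unfolding h by simp_all
    with mn show ?thesis by (metis mult_eq_0_iff)
  qed
  have "(x $ 1 - x $ 3 * A $ 1) * (z $ 2 - z $ 3 * A $ 2)
      - (x $ 2 - x $ 3 * A $ 2) * (z $ 1 - z $ 3 * A $ 1) = 0"
    by (rule det[OF *[OF l(3) nz(1)] *[OF l(4) nz(2)] nl])
  then show ?thesis by (simp add: ctr_coord_def cplx_def algebra_simps)
qed

lemma reflection_cplx:
  assumes "u \<noteq> 0"
  shows "cplx ((2 * (v \<bullet> u) / (u \<bullet> u)) *\<^sub>R u - v) =
    (cplx u)\<^sup>2 * cnj (cplx v) / of_real ((norm u)\<^sup>2)"
proof -
  have "complex_of_real (2 * (v \<bullet> u)) = cplx v * cnj (cplx u) + cnj (cplx v * cnj (cplx u))"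
    by (simp only: inner_cplx complex_add_cnj of_real_mult of_real_numeral)
  moreover have "complex_of_real (u \<bullet> u) = cplx u * cnj (cplx u)"
    by (simp add: inner_cplx complex_norm_square [symmetric] flip: power2_eq_square)
  moreover have "complex_of_real ((norm u)\<^sup>2) = cplx u * cnj (cplx u)"
    by (metis norm_cplx complex_norm_square)
  moreover have "cplx u \<noteq> 0" using assms by (metis cplx_eq_iff cplx_simps(5))
  ultimately show ?thesis
    by (simp add: field_simps power2_eq_square)
qed

text \<open>Only the direction of the image matters later, so one real \<open>k\<close> absorbs both
  the norm of \<open>u\<close> and the factor between two representatives.\<close>

lemma proj_reflection_ctr_coord:
  assumes nz: "x \<noteq> 0" "q \<noteq> 0" and u: "u \<noteq> 0"
    and q: "abs_projplane q = proj_reflection A u (abs_projplane x)"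
  obtains k :: real where "ctr_coord A 1 q = of_real k * (cplx u)\<^sup>2 * cnj (ctr_coord A 1 x)"
proof -
  define y where "y = (let w = x $ 3; v = xy_part x - w *\<^sub>R A
     in homog (w *\<^sub>R A + (2 * (v \<bullet> u) / (u \<bullet> u)) *\<^sub>R u - v) w)"
  have eq: "proj_reflection A u (abs_projplane x) = abs_projplane y"
    unfolding y_def by (rule proj_reflection.abs_eq) (rule proj_eq_self[OF nz(1)])
  have yc: "ctr_coord A 1 y = (cplx u)\<^sup>2 * cnj (ctr_coord A 1 x) / of_real ((norm u)\<^sup>2)"
  proof -
    have "xy_part y - y $ 3 *\<^sub>R A = (2 * ((xy_part x - x $ 3 *\<^sub>R A) \<bullet> u) / (u \<bullet> u)) *\<^sub>R u
        - (xy_part x - x $ 3 *\<^sub>R A)"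
      by (simp add: y_def Let_def)
    then show ?thesis
      unfolding ctr_coord_def by (simp only: reflection_cplx[OF u]) simp
  qed
  have "y \<noteq> 0"
  proof
    assume "y = 0"
    then have "y $ 3 = 0" "ctr_coord A 1 y = 0" using ctr_coord_eq_0_iff[of 1 A y] by simp_all
    then have "x $ 3 = 0" by (simp add: y_def Let_def)
    moreover have "cplx u \<noteq> 0" using u by (metis cplx_eq_iff cplx_simps(5))
    then have "ctr_coord A 1 x = 0" using \<open>ctr_coord A 1 y = 0\<close> u by (simp add: yc)
    ultimately show False using ctr_coord_eq_0_iff[of 1 A x] nz by simp
  qed
  then obtain k where "q = k *\<^sub>R y"
    using abs_projplane_eq_iff[of y q] nz q eq by auto
  then show thesis
    by (intro that[of "k / (norm u)\<^sup>2"]) (simp add: yc)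
qed

text \<open>Unit numbers satisfy x + y = x y (x' + y'), hence (x + y)^2 = |x + y|^2 x y, where |x +
  y|^2 = 2 + 2 Re (x y'). Squaring thus removes the normalisation by \<open>sgn\<close>, and the
  side vectors enter polynomially.\<close>

lemma bisector_square:
  assumes "v \<noteq> 0" "w \<noteq> 0"
  obtains k :: real where "(cplx (sgn v + sgn w))\<^sup>2 = of_real k * (cplx v * cplx w)"
proof -
  have *: "(x + y)\<^sup>2 = of_real (2 + 2 * Re (x * cnj y)) * (x * y)" if "cmod x = 1" "cmod y = 1" for x y
  proof -
    have x: "x * cnj x = 1" "y * cnj y = 1" using that by (simp_all add: complex_norm_square [symmetric])
    have "complex_of_real (2 + 2 * Re (x * cnj y)) = 2 + (x * cnj y + cnj x * y)"
      using complex_add_cnj[of "x * cnj y"] by simp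
    then show ?thesis using x by algebra
  qed
  have s: "cplx (sgn v) = of_real (inverse (norm v)) * cplx v" for v
    by (simp add: sgn_div_norm divide_inverse_commute)
  have "cmod (cplx (sgn v)) = 1" "cmod (cplx (sgn w)) = 1"
    using assms by (simp_all add: norm_cplx norm_sgn)
  from *[OF this] show thesis
    by (intro that[of "(2 + 2 * Re (cplx (sgn v) * cnj (cplx (sgn w)))) * inverse (norm v) * inverse (norm w)"])
      (simp add: s mult_ac)
qed

text \<open>Modulo pi, the arguments of \<open>p\<close> and \<open>q\<close> seen from
  \<open>A\<close> add up to twice that of the bisector, which is the sum of the arguments of the
  two sides. So the product of the two points is parallel to the product of the sides.\<close>

lemma reflect_in_bisector_Im:
  assumes nz: "p \<noteq> 0" "q \<noteq> 0" and u: "sgn (B - A) + sgn (C - A) \<noteq> 0" and BC: "B \<noteq> A" "C \<noteq> A"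
    and mem: "abs_projplane q \<in> reflect_in_bisector A B C ` proj_join (affine_pt A) (abs_projplane p)"
  shows "Im (cplx (B - A) * cplx (C - A) * cnj (ctr_coord A 1 p * ctr_coord A 1 q)) = 0"
proof -
  define u where "u = sgn (B - A) + sgn (C - A)"
  obtain X where X: "X \<in> proj_join (affine_pt A) (abs_projplane p)"
    "abs_projplane q = proj_reflection A u X"
    using mem by (auto simp: reflect_in_bisector_def u_def)
  obtain x where x: "x \<noteq> 0" "X = abs_projplane x" by (rule projplane_cases)
  have im: "Im (ctr_coord A 1 x * cnj (ctr_coord A 1 p)) = 0"
    using proj_join_parallel X x nz by blast
  obtain k where k: "ctr_coord A 1 q = of_real k * (cplx u)\<^sup>2 * cnj (ctr_coord A 1 x)"
    using proj_reflection_ctr_coord X(2) x nz u u_def by metis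
  obtain m where m: "(cplx u)\<^sup>2 = of_real m * (cplx (B - A) * cplx (C - A))"
    using bisector_square[of "B - A" "C - A"] BC unfolding u_def by auto
  have "(cplx u)\<^sup>2 \<noteq> 0" using u by (metis u_def cplx_eq_iff cplx_simps(5) zero_eq_power2)
  with m have "m \<noteq> 0" by auto
  \<comment> \<open>The factor \<open>m\<close> turns the product of the sides into u^2. The
    conjugate of u^2 comes from \<open>q\<close>, and together they give |u|^4.\<close>
  have "of_real m * (cplx (B - A) * cplx (C - A) * cnj (ctr_coord A 1 p * ctr_coord A 1 q))
    = of_real (k * cmod (cplx u) ^ 4) * (ctr_coord A 1 x * cnj (ctr_coord A 1 p))"
  proof -
    have "complex_of_real (cmod (cplx u) ^ 4) = (cplx u)\<^sup>2 * cnj ((cplx u)\<^sup>2)"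
      using complex_norm_square[of "(cplx u)\<^sup>2"] by (simp add: norm_power)
    then show ?thesis by (simp only: k mult.assoc[symmetric] m[symmetric] complex_cnj_mult complex_cnj_cnj complex_cnj_complex_of_real of_real_mult)
       (simp add: m mult_ac)
  qed
  then have "Im (of_real m * (cplx (B - A) * cplx (C - A) * cnj (ctr_coord A 1 p * ctr_coord A 1 q))) = 0"
    using im by (simp only: Im_complex_of_real mult.commute) simp
  moreover have "Im (of_real m * W) = m * Im W" for W by simp
  ultimately show ?thesis using \<open>m \<noteq> 0\<close> by (metis mult_eq_0_iff)
qed

section \<open>Triangles inscribed in the unit circle\<close>

text \<open>In this form \<open>algebra\<close> can treat a number and its conjugate as two
  variables with product 1.\<close>

lemma cnj_unit: "cmod a = 1 \<Longrightarrow> cnj a * a = 1"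
  by (metis complex_norm_square mult.commute of_real_1 one_power2)

text \<open>Conjugation divides the chord b - a by -a b and the chord c - a by -a c; a real ratio of
  the two would force b = c.\<close>

lemma unit_not_parallel:
  assumes unit: "cmod a = 1" "cmod b = 1" "cmod c = 1"
    and neq: "b \<noteq> a" "c \<noteq> b" and eq: "b - a = of_real t * (c - a)"
  shows False
proof -
  have "cnj b - cnj a = of_real t * (cnj c - cnj a)"
    using arg_cong[OF eq, of cnj] by simp
  with eq cnj_unit[OF unit(1)] cnj_unit[OF unit(2)] cnj_unit[OF unit(3)]
  have "(b - a) * (c - b) = 0" by algebra
  with neq show False by simp
qed

text \<open>The product V of the sides at \<open>a\<close> equals a^2 b c V'. Hence V X' is real
  only if X = a^2 b c X', and distributing a^2 over the two factors of X' clears the conjugates of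
  \<open>a\<close>.\<close>

lemma isogonal_at_vertex:
  assumes unit: "cmod a = 1" "cmod b = 1" "cmod c = 1" and neq: "b \<noteq> a" "c \<noteq> a"
    and Im0: "Im ((b - a) * (c - a) * cnj ((p - a * of_real u) * (q - a * of_real w))) = 0"
  shows "(p - a * of_real u) * (q - a * of_real w) =
    b * c * (a * cnj p - of_real u) * (a * cnj q - of_real w)"
proof -
  define X where "X = (p - a * of_real u) * (q - a * of_real w)"
  define V where "V = (b - a) * (c - a)"
  have "cnj (V * cnj X) = V * cnj X"
    using Im0 unfolding V_def X_def by (metis Reals_cnj_iff complex_is_Real_iff)
  then have 1: "cnj V * X = V * cnj X" by simp
  have 2: "cnj V * (a^2 * b * c) = V"
    using cnj_unit[OF unit(1)] cnj_unit[OF unit(2)] cnj_unit[OF unit(3)]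
    unfolding V_def complex_cnj_mult complex_cnj_diff by algebra
  have 3: "a^2 * cnj X = (a * cnj p - of_real u) * (a * cnj q - of_real w)"
    using cnj_unit[OF unit(1)]
    unfolding X_def complex_cnj_mult complex_cnj_diff complex_cnj_complex_of_real by algebra
  have "V * (X - a^2 * b * c * cnj X) = 0"
    using 1 2 by algebra
  moreover have "V \<noteq> 0" using neq by (simp add: V_def)
  ultimately have "X = b * c * (a^2 * cnj X)" by (simp add: mult_ac)
  then show ?thesis unfolding 3 by (simp add: X_def mult_ac)
qed

text \<open>After expansion, the conditions at \<open>a\<close> and at \<open>b\<close> share the
  terms p q and a b c (w p' + u q'). These cancel in the difference, which is a - b times the
  claim.\<close>

lemma isogonal_equation:
  assumes unit: "cmod a = 1" "cmod b = 1" "cmod c = 1" and neq: "a \<noteq> b" "b \<noteq> c" "a \<noteq> c"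
    and a: "Im ((b - a) * (c - a) * cnj ((p - a * of_real u) * (q - a * of_real w))) = 0"
    and b: "Im ((c - b) * (a - b) * cnj ((p - b * of_real u) * (q - b * of_real w))) = 0"
  shows "p * of_real w + q * of_real u + a * b * c * cnj p * cnj q = (a + b + c) * of_real (u * w)"
proof -
  have 1: "(p - a * of_real u) * (q - a * of_real w) =
    b * c * (a * cnj p - of_real u) * (a * cnj q - of_real w)"
    using isogonal_at_vertex[OF unit(1-3) _ _ a] neq by blast
  have 2: "(p - b * of_real u) * (q - b * of_real w) =
    c * a * (b * cnj p - of_real u) * (b * cnj q - of_real w)"
    using isogonal_at_vertex[OF unit(2,3,1) _ _ b] neq by blast
  have "(a - b) * (p * of_real w + q * of_real u + a * b * c * cnj p * cnj q
      - (a + b + c) * (of_real u * of_real w)) = 0"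
    using 1 2 by algebra
  with neq show ?thesis by simp
qed

text \<open>Since b' - c' = -(b - c) / (b c), the altitude from \<open>a\<close> has the equation h
  - a = b c (h' - a'), and similarly from \<open>b\<close>. Eliminating h' gives
  \<open>h\<close>.\<close>

lemma orthocenter_unit:
  assumes unit: "cmod a = 1" "cmod b = 1" "cmod c = 1" and neq: "a \<noteq> b" "b \<noteq> c" "a \<noteq> c"
    and a: "Re ((h - a) * cnj (b - c)) = 0" and b: "Re ((h - b) * cnj (c - a)) = 0"
  shows "h = a + b + c"
proof -
  have *: "x * cnj y + cnj x * y = 0" if "Re (x * cnj y) = 0" for x y
    using complex_add_cnj[of "x * cnj y"] unfolding that by simp
  note u = cnj_unit[OF unit(1)] cnj_unit[OF unit(2)] cnj_unit[OF unit(3)]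
  have "(h - a) * (cnj b - cnj c) + (cnj h - cnj a) * (b - c) = 0"
       "(h - b) * (cnj c - cnj a) + (cnj h - cnj b) * (c - a) = 0"
    using *[OF a] *[OF b] by simp_all
  with u have 1: "(b - c) * ((h - a) - b * c * (cnj h - cnj a)) = 0"
    and 2: "(c - a) * ((h - b) - c * a * (cnj h - cnj b)) = 0"
    by algebra+
  from 1 2 neq have 1: "(h - a) - b * c * (cnj h - cnj a) = 0"
    and 2: "(h - b) - c * a * (cnj h - cnj b) = 0" by auto
  have "(b - a) * (h - (a + b + c)) = 0" using 1 2 u by algebra
  with neq show ?thesis by simp
qed

text \<open>If x + y = -z has modulus 1, the parallelogram law gives |x - y|^2 = 4 - 1 = 3. This is
  how a non-equilateral triangle gets an orthocenter different from its circumcenter.\<close>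

lemma equilateral_unit:
  assumes unit: "cmod a = 1" "cmod b = 1" "cmod c = 1" and s: "a + b + c = 0"
  shows "cmod (a - b) = cmod (b - c)"
proof -
  have "(cmod (x - y))\<^sup>2 = 3" if "x + y + z = 0" "cmod x = 1" "cmod y = 1" "cmod z = 1" for x y z
  proof -
    have "x + y = - z" using that(1) by (simp add: add_eq_0_iff2)
    then have "(cmod (x + y))\<^sup>2 = 1" using that by simp
    moreover have "(cmod (x + y))\<^sup>2 + (cmod (x - y))\<^sup>2 = 2 * ((cmod x)\<^sup>2 + (cmod y)\<^sup>2)"
      unfolding cmod_power2 by (simp add: power2_eq_square algebra_simps)
    ultimately show ?thesis using that by simp
  qed
  from this[of a b c] this[of b c a] have "(cmod (a - b))\<^sup>2 = (cmod (b - c))\<^sup>2"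
    using assms by (simp add: ac_simps)
  then show ?thesis by (simp add: power2_eq_iff_nonneg)
qed


section \<open>The quadratic form attached to four points of the circle\<close>

text \<open>
  A point of the unit circle satisfies \<open>cnj z = 1 / z\<close>, which turns the coefficient of \<open>m\<close> at \<open>w = 1\<close>
  into the monic quartic with elementary symmetric functions \<open>e1, \<dots>, e4\<close>, divided by \<open>z\<^sup>2\<close>.
  Hence the form vanishes at the four roots.
\<close>

definition pencil_form ::
    "complex \<Rightarrow> complex \<Rightarrow> complex \<Rightarrow> complex \<Rightarrow> complex \<Rightarrow> complex \<Rightarrow> complex \<Rightarrow> complex \<Rightarrow> complex" where
  "pencil_form e1 e2 e3 e4 m k z w =
    m * (z\<^sup>2 + e4 * (cnj z)\<^sup>2 - e1 * z * w - e3 * cnj z * w + e2 * w\<^sup>2) + k * (z * cnj z - w\<^sup>2)"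

lemma pencil_form_isogonal:
  fixes l m w :: real
  assumes unit: "cmod a = 1" "cmod b = 1" "cmod c = 1"
    and eq: "of_real m * q + of_real l * (b * c + c * a + a * b) * cnj q = of_real (m - l) * (a + b + c) * of_real w"
  shows "pencil_form (a + b + c + d) (a * b + a * c + a * d + b * c + b * d + c * d)
      (b * c * d + a * c * d + a * b * d + a * b * c) (a * b * c * d)
      (of_real m) (of_real l * (a * b + a * c + a * d + b * c + b * d + c * d)) q (of_real w) = 0"
proof -
  note u = cnj_unit[OF unit(1)] cnj_unit[OF unit(2)] cnj_unit[OF unit(3)]
  have "of_real m * cnj q + of_real l * (cnj b * cnj c + cnj c * cnj a + cnj a * cnj b) * q
      = of_real (m - l) * (cnj a + cnj b + cnj c) * of_real w"
    using arg_cong[OF eq, of cnj] by simp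
  \<comment> \<open>The conjugate equation is multiplied by s3 = a b c, using s3 s2' = s1 and s3 s1'
    = s2.\<close>
  with u have "a * b * c * of_real m * cnj q + of_real l * (a + b + c) * q
      = of_real (m - l) * (b * c + c * a + a * b) * of_real w"
    by algebra
  \<comment> \<open>the form is \<open>q - d w\<close> times \<open>eq\<close> plus \<open>d q* - w\<close> times this equation, \<open>q*\<close> the conjugate of \<open>q\<close>\<close>
  with eq show ?thesis
    unfolding pencil_form_def of_real_diff by algebra
qed

lemma pencil_form_vertex:
  assumes "cmod a = 1"
  shows "pencil_form (a + b + c + d) (a * b + a * c + a * d + b * c + b * d + c * d)
      (b * c * d + a * c * d + a * b * d + a * b * c) (a * b * c * d) m k a 1 = 0"
  using cnj_unit[OF assms] unfolding pencil_form_def power_one mult_1_right by algebra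

text \<open>From s2 = s3 s1' one gets |s2| = |s1|, so multiplying the equation by its conjugate
  leaves |q|^2 = w^2 once the nonzero |s1|^2 is cancelled.\<close>

lemma isogonal_of_infinity_on_circle:
  fixes w :: real
  assumes unit: "cmod a = 1" "cmod b = 1" "cmod c = 1" and nz: "a + b + c \<noteq> 0"
    and eq: "(b * c + c * a + a * b) * cnj q = - (a + b + c) * of_real w"
  shows "q * cnj q = (of_real w)\<^sup>2"
proof -
  have eq': "(cnj b * cnj c + cnj c * cnj a + cnj a * cnj b) * q = - (cnj a + cnj b + cnj c) * of_real w"
    using arg_cong[OF eq, of cnj] by simp
  have nz': "cnj a + cnj b + cnj c \<noteq> 0"
    using nz by (metis complex_cnj_add complex_cnj_zero_iff)
  have "(a + b + c) * (cnj a + cnj b + cnj c) * (q * cnj q - (of_real w)\<^sup>2) = 0"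
    using eq eq' cnj_unit[OF unit(1)] cnj_unit[OF unit(2)] cnj_unit[OF unit(3)] by algebra
  with nz nz' show ?thesis by simp
qed

section \<open>From complex quadratic forms to real conics\<close>

text \<open>At real coordinates the real and imaginary parts of the form are real quadratic forms,
  both zero on \<open>S\<close>, and at least one of them has a nonzero coefficient.\<close>

lemma complex_quadric_in_conic:
  assumes nz: "(c1, c2, c3, c4, c5, c6) \<noteq> (0, 0, 0, 0, 0, 0 :: complex)"
    and S: "\<And>X. X \<in> S \<Longrightarrow> \<exists>x. x \<noteq> 0 \<and> X = abs_projplane x \<and>
      c1 * of_real ((x $ 1)\<^sup>2) + c2 * of_real ((x $ 2)\<^sup>2) + c3 * of_real ((x $ 3)\<^sup>2)
      + c4 * of_real (x $ 1 * x $ 2) + c5 * of_real (x $ 1 * x $ 3) + c6 * of_real (x $ 2 * x $ 3) = 0"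
  shows "\<exists>T. is_conic T \<and> S \<subseteq> T"
proof -
  \<comment> \<open>\<open>f\<close> stands for \<open>Re\<close> or \<open>Im\<close>; real
    linearity serves both cases at once.\<close>
  have *: "\<exists>T. is_conic T \<and> S \<subseteq> T"
    if lin: "\<And>x y. f (x + y) = f x + f y" "\<And>x r. f (x * of_real r) = f x * r" "f 0 = 0"
      and nzf: "(f c1, f c2, f c3, f c4, f c5, f c6) \<noteq> (0, 0, 0, 0, 0, 0 :: real)"
    for f :: "complex \<Rightarrow> real"
  proof (intro exI conjI)
    show "is_conic {X. quadratic_zero (f c1) (f c2) (f c3) (f c4) (f c5) (f c6) X}"
      using nzf unfolding is_conic_def by blast
    show "S \<subseteq> {X. quadratic_zero (f c1) (f c2) (f c3) (f c4) (f c5) (f c6) X}"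
    proof
      fix X assume "X \<in> S"
      then obtain x where x: "x \<noteq> 0" "X = abs_projplane x" and
        eq: "c1 * of_real ((x $ 1)\<^sup>2) + c2 * of_real ((x $ 2)\<^sup>2) + c3 * of_real ((x $ 3)\<^sup>2)
          + c4 * of_real (x $ 1 * x $ 2) + c5 * of_real (x $ 1 * x $ 3) + c6 * of_real (x $ 2 * x $ 3) = 0"
        using S by blast
      show "X \<in> {X. quadratic_zero (f c1) (f c2) (f c3) (f c4) (f c5) (f c6) X}"
        using arg_cong[OF eq, of f]
        by (simp only: lin x(2) mem_Collect_eq quadratic_zero.abs_eq[OF proj_eq_self[OF x(1)]] mult.assoc)
    qed
  qed
  consider "(Re c1, Re c2, Re c3, Re c4, Re c5, Re c6) \<noteq> (0, 0, 0, 0, 0, 0)"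
    | "(Im c1, Im c2, Im c3, Im c4, Im c5, Im c6) \<noteq> (0, 0, 0, 0, 0, 0)"
    using nz by (auto simp: complex_eq_iff)
  then show ?thesis
    by cases (rule *[of Re] *[of Im]; simp)+
qed

lemma pencil_form_in_conic:
  assumes r: "r \<noteq> 0" and nz: "m \<noteq> 0 \<or> k \<noteq> 0"
    and S: "\<And>X. X \<in> S \<Longrightarrow> \<exists>x. x \<noteq> 0 \<and> X = abs_projplane x \<and>
      pencil_form e1 e2 e3 e4 m k (ctr_coord Z r x) (of_real (x $ 3)) = 0"
  shows "\<exists>T. is_conic T \<and> S \<subseteq> T"
proof -
  define s where "s = complex_of_real (inverse r)"
  define z where "z = cplx Z * s"
  \<comment> \<open>For real coordinates x, y, w of a representative, \<open>ctr_coord\<close> is s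
    (x + i y) - z w. The numbers \<open>c1\<close> to \<open>c6\<close> are the coefficients of x^2,
    y^2, w^2, x y, x w, y w after this substitution.\<close>
  define c1 where "c1 = s^2 * (m * (1 + e4) + k)"
  define c2 where "c2 = s^2 * (k - m * (1 + e4))"
  define c3 where "c3 = m * (z^2 + e4 * (cnj z)^2 + e1 * z + e3 * cnj z + e2) + k * (z * cnj z - 1)"
  define c4 where "c4 = s^2 * 2 * \<i> * m * (1 - e4)"
  define c5 where "c5 = - s * (m * (2 * z + 2 * e4 * cnj z + e1 + e3) + k * (z + cnj z))"
  define c6 where "c6 = s * \<i> * (m * (- 2 * z + 2 * e4 * cnj z - e1 + e3) + k * (z - cnj z))"
  have s0: "s \<noteq> 0" using r by (simp add: s_def)
  have "(c1, c2, c3, c4, c5, c6) \<noteq> (0, 0, 0, 0, 0, 0)"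
  proof
    assume "(c1, c2, c3, c4, c5, c6) = (0, 0, 0, 0, 0, 0)"
    \<comment> \<open>The coefficients of x^2, y^2 and x y already determine the pair: the first two
      give \<open>k\<close> by addition, and by subtraction, together with the third, they give
      \<open>m\<close>.\<close>
    then have "m * (1 + e4) + k = 0" "k - m * (1 + e4) = 0" "m * (1 - e4) = 0"
      using s0 by (auto simp: c1_def c2_def c4_def)
    then have "2 * k = 0" "2 * m = 0" by algebra+
    with nz show False by simp
  qed
  then show ?thesis
  proof (rule complex_quadric_in_conic)
    fix X assume "X \<in> S"
    then obtain x where x: "x \<noteq> 0" "X = abs_projplane x"
      and eq: "pencil_form e1 e2 e3 e4 m k (ctr_coord Z r x) (of_real (x $ 3)) = 0" using S by blast
    have t: "ctr_coord Z r x = s * (of_real (x $ 1) + \<i> * of_real (x $ 2)) - z * of_real (x $ 3)"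
      by (simp add: ctr_coord_def z_def s_def divide_inverse left_diff_distrib)
        (simp add: cplx_def complex_eq_iff)
    have t': "cnj (ctr_coord Z r x) = s * (of_real (x $ 1) - \<i> * of_real (x $ 2)) - cnj z * of_real (x $ 3)"
      unfolding t by (simp add: s_def)
    have "\<i> * \<i> = - 1" by simp
    with eq have "c1 * of_real ((x $ 1)\<^sup>2) + c2 * of_real ((x $ 2)\<^sup>2) + c3 * of_real ((x $ 3)\<^sup>2)
      + c4 * of_real (x $ 1 * x $ 2) + c5 * of_real (x $ 1 * x $ 3) + c6 * of_real (x $ 2 * x $ 3) = 0"
      unfolding pencil_form_def t' unfolding t c1_def c2_def c3_def c4_def c5_def c6_def
        of_real_mult of_real_power by algebra
    with x show "\<exists>x. x \<noteq> 0 \<and> X = abs_projplane x \<and>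
      c1 * of_real ((x $ 1)\<^sup>2) + c2 * of_real ((x $ 2)\<^sup>2) + c3 * of_real ((x $ 3)\<^sup>2)
      + c4 * of_real (x $ 1 * x $ 2) + c5 * of_real (x $ 1 * x $ 3) + c6 * of_real (x $ 2 * x $ 3) = 0"
      by blast
  qed
qed

section \<open>Transfer to a circle of any center and radius\<close>

text \<open>Used to see that the bisector direction at a vertex can vanish only if the two sides are
  parallel, which is impossible for three distinct points of a circle.\<close>

lemma sgn_add_sgn_eq_0:
  fixes v w :: "'a::real_normed_vector"
  assumes "sgn v + sgn w = 0" "v \<noteq> 0"
  obtains t where "v = t *\<^sub>R w"
proof -
  have "sgn v = - sgn w" using assms(1) by (simp add: add_eq_0_iff2)
  then have "norm v *\<^sub>R sgn v = (- norm v / norm w) *\<^sub>R w"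
    by (simp add: sgn_div_norm divide_inverse)
  then have "v = (- norm v / norm w) *\<^sub>R w"
    using assms(2) by (simp add: sgn_div_norm)
  then show thesis by (rule that)
qed

text \<open>The value of \<open>ctr_coord\<close> at a finite point; it has modulus 1 on the
  circle.\<close>

definition unit_coord :: "real^2 \<Rightarrow> real \<Rightarrow> real^2 \<Rightarrow> complex" where
  "unit_coord Z r X = cplx (X - Z) / of_real r"

lemma unit_coord_diff:
  "r \<noteq> 0 \<Longrightarrow> cplx (X - Y) = of_real r * (unit_coord Z r X - unit_coord Z r Y)"
  by (simp add: unit_coord_def field_simps)

lemma unit_coord_eq_iff: "r \<noteq> 0 \<Longrightarrow> unit_coord Z r X = unit_coord Z r Y \<longleftrightarrow> X = Y"
  by (auto simp: unit_coord_def cplx_eq_iff)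

lemma cmod_unit_coord: "r > 0 \<Longrightarrow> dist X Z = r \<Longrightarrow> cmod (unit_coord Z r X) = 1"
  by (simp add: unit_coord_def norm_divide norm_cplx dist_norm del: cplx_simps)

lemma dist_unit_coord: "r > 0 \<Longrightarrow> dist X Y = r * cmod (unit_coord Z r X - unit_coord Z r Y)"
  by (metis abs_of_pos dist_norm less_irrefl norm_cplx norm_mult norm_of_real unit_coord_diff)

lemma reflect_in_bisector_unit:
  fixes A B C Z r
  defines "a \<equiv> unit_coord Z r A" and "b \<equiv> unit_coord Z r B" and "c \<equiv> unit_coord Z r C"
  assumes r: "r > 0" and circ: "dist A Z = r" "dist B Z = r" "dist C Z = r"
    and neq: "A \<noteq> B" "B \<noteq> C" "A \<noteq> C" and nz: "p \<noteq> 0" "q \<noteq> 0"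
    and mem: "abs_projplane q \<in> reflect_in_bisector A B C ` proj_join (affine_pt A) (abs_projplane p)"
  shows "Im ((b - a) * (c - a) * cnj ((ctr_coord Z r p - a * of_real (p $ 3)) *
      (ctr_coord Z r q - a * of_real (q $ 3)))) = 0"
proof -
  have r0: "r \<noteq> 0" using r by simp
  have unit: "cmod a = 1" "cmod b = 1" "cmod c = 1"
    using r circ by (simp_all add: a_def b_def c_def cmod_unit_coord)
  have d: "cplx (B - A) = of_real r * (b - a)" "cplx (C - A) = of_real r * (c - a)"
    unfolding a_def b_def c_def by (rule unit_coord_diff[OF r0])+
  have "sgn (B - A) + sgn (C - A) \<noteq> 0"
  proof
    assume "sgn (B - A) + sgn (C - A) = 0"
    then obtain t where "B - A = t *\<^sub>R (C - A)"
      using sgn_add_sgn_eq_0[of "B - A" "C - A"] neq by auto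
    then have "cplx (B - A) = of_real t * cplx (C - A)" by (simp only: cplx_simps)
    then have "b - a = of_real t * (c - a)" using r0 unfolding d by simp
    moreover have "b \<noteq> a" "c \<noteq> b"
      using neq r0 by (auto simp: a_def b_def c_def unit_coord_eq_iff)
    ultimately show False using unit_not_parallel unit by blast
  qed
  from reflect_in_bisector_Im[OF nz this _ _ mem] neq
  have "Im (cplx (B - A) * cplx (C - A) * cnj (ctr_coord A 1 p * ctr_coord A 1 q)) = 0" by blast
  moreover have s: "ctr_coord A 1 x = of_real r * (ctr_coord Z r x - a * of_real (x $ 3))" for x
    using ctr_coord_shift[OF r0] by (simp add: a_def unit_coord_def mult.commute)
  \<comment> \<open>Each of the two sides and two points contributes one factor
    \<open>r\<close>.\<close>
  have "cplx (B - A) * cplx (C - A) * cnj (ctr_coord A 1 p * ctr_coord A 1 q) =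
    of_real (r ^ 4) * ((b - a) * (c - a) * cnj ((ctr_coord Z r p - a * of_real (p $ 3)) *
      (ctr_coord Z r q - a * of_real (q $ 3))))"
    unfolding d s by (simp add: eval_nat_numeral mult_ac)
  ultimately have "Im (of_real (r ^ 4) * ((b - a) * (c - a) * cnj ((ctr_coord Z r p - a * of_real (p $ 3)) *
      (ctr_coord Z r q - a * of_real (q $ 3))))) = 0" by (simp only:)
  moreover have "Im (of_real x * W) = x * Im W" for x W by simp
  ultimately show ?thesis using r0 by (metis mult_eq_0_iff power_not_zero)
qed

lemma orthocenter_unit_coord:
  assumes r: "r > 0" and circ: "dist A Z = r" "dist B Z = r" "dist C Z = r"
    and neq: "A \<noteq> B" "B \<noteq> C" "A \<noteq> C" and H: "is_orthocenter A B C H"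
  shows "unit_coord Z r H = unit_coord Z r A + unit_coord Z r B + unit_coord Z r C"
proof (rule orthocenter_unit)
  have r0: "r \<noteq> 0" using r by simp
  have *: "Re ((unit_coord Z r W - unit_coord Z r X) * cnj (unit_coord Z r Y - unit_coord Z r U)) = 0"
    if "(W - X) \<bullet> (Y - U) = 0" for W X Y U
  proof -
    have "(W - X) \<bullet> (Y - U) = r\<^sup>2 *
      Re ((unit_coord Z r W - unit_coord Z r X) * cnj (unit_coord Z r Y - unit_coord Z r U))"
      unfolding inner_cplx unit_coord_diff[OF r0, where Z = Z]
      by (simp add: power2_eq_square algebra_simps)
    with that r0 show ?thesis by simp
  qed
  show "Re ((unit_coord Z r H - unit_coord Z r A) * cnj (unit_coord Z r B - unit_coord Z r C)) = 0"
    "Re ((unit_coord Z r H - unit_coord Z r B) * cnj (unit_coord Z r C - unit_coord Z r A)) = 0"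
    using H by (simp_all only: is_orthocenter_def *)
  show "cmod (unit_coord Z r A) = 1" "cmod (unit_coord Z r B) = 1" "cmod (unit_coord Z r C) = 1"
    using r circ by (simp_all add: cmod_unit_coord)
  show "unit_coord Z r A \<noteq> unit_coord Z r B" "unit_coord Z r B \<noteq> unit_coord Z r C"
    "unit_coord Z r A \<noteq> unit_coord Z r C" using neq r0 by (simp_all add: unit_coord_eq_iff)
qed

lemma equilateral_unit_coord:
  assumes r: "r > 0" and circ: "dist A Z = r" "dist B Z = r" "dist C Z = r"
    and s: "unit_coord Z r A + unit_coord Z r B + unit_coord Z r C = 0"
  shows "equilateral A B C"
  unfolding equilateral_def dist_unit_coord[OF r, of _ _ Z]
  using equilateral_unit[of "unit_coord Z r A" "unit_coord Z r B" "unit_coord Z r C"]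
    equilateral_unit[of "unit_coord Z r B" "unit_coord Z r C" "unit_coord Z r A"] s
  by (simp add: r circ cmod_unit_coord ac_simps)

section \<open>Points of the Euler line and their signed ratio\<close>

text \<open>
  With the circumcenter as origin, a point of the Euler line is \<open>(l H : m)\<close> for real weights \<open>l, m\<close>.
  Its signed ratio is \<open>1 - m / l\<close>, so equal ratios mean equal \<open>(l : m)\<close>; the functions below
  choose the representatives.
\<close>

definition ratio_l :: "ereal \<Rightarrow> real" where
  "ratio_l t = (if t = \<infinity> then 0 else 1)"

definition ratio_m :: "ereal \<Rightarrow> real" where
  "ratio_m t = (if t = \<infinity> then 1 else 1 - real_of_ereal t)"

lemma affine_pt_eq_iff: "affine_pt p = affine_pt q \<longleftrightarrow> p = q"
proof
  assume "affine_pt p = affine_pt q"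
  then obtain k where k: "homog q 1 = k *\<^sub>R homog p 1"
    by (auto simp: affine_pt.abs_eq abs_projplane_eq_iff)
  have "k = 1" using arg_cong[OF k, of "\<lambda>x. x $ 3"] by simp
  then show "p = q" using arg_cong[OF k, of xy_part] by simp
qed simp

text \<open>For P = Z + s (H - Z) the vectors from P to \<open>H\<close> and to \<open>Z\<close> are
  1 - s and -s times the nonzero vector H - Z, so the definite description has exactly one
  candidate.\<close>

lemma signed_ratio_affine:
  assumes "H \<noteq> Z" "s \<noteq> 0"
  shows "signed_ratio (affine_pt (Z + s *\<^sub>R (H - Z))) H Z = ereal (1 - 1 / s)"
proof -
  have "(THE t. \<exists>p. affine_pt (Z + s *\<^sub>R (H - Z)) = affine_pt p \<and> H - p = t *\<^sub>R (Z - p)) = 1 - 1 / s"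
  proof (rule the_equality)
    have e: "H - (Z + s *\<^sub>R (H - Z)) = (1 - s) *\<^sub>R (H - Z)"
      "Z - (Z + s *\<^sub>R (H - Z)) = (- s) *\<^sub>R (H - Z)" by (simp_all add: algebra_simps)
    have "(1 - 1 / s) * (- s) = 1 - s" using assms by (simp add: field_simps)
    then show "\<exists>p. affine_pt (Z + s *\<^sub>R (H - Z)) = affine_pt p \<and> H - p = (1 - 1 / s) *\<^sub>R (Z - p)"
      by (intro exI[of _ "Z + s *\<^sub>R (H - Z)"]) (simp only: e scaleR_scaleR simp_thms)
    fix t assume "\<exists>p. affine_pt (Z + s *\<^sub>R (H - Z)) = affine_pt p \<and> H - p = t *\<^sub>R (Z - p)"
    then have "H - (Z + s *\<^sub>R (H - Z)) = t *\<^sub>R (Z - (Z + s *\<^sub>R (H - Z)))"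
      by (auto simp only: affine_pt_eq_iff)
    then have "(1 - s) *\<^sub>R (H - Z) = (t * (- s)) *\<^sub>R (H - Z)"
      by (simp only: e scaleR_scaleR)
    then have "1 - s = t * (- s)" using assms(1) by (simp only: scaleR_cancel_right right_minus_eq) simp
    then show "t = 1 - 1 / s" using assms(2) by (simp add: field_simps)
  qed
  moreover have "\<not> at_infinity (affine_pt p)" for p
    by (simp add: affine_pt.abs_eq at_infinity.abs_eq proj_eq_self)
  ultimately show ?thesis using assms by (simp add: signed_ratio_def affine_pt_eq_iff)
qed

lemma euler_line_point:
  assumes H: "H \<noteq> Z" and mem: "P \<in> proj_join (affine_pt Z) (affine_pt H)"
  defines "l \<equiv> ratio_l (signed_ratio P H Z)" and "m \<equiv> ratio_m (signed_ratio P H Z)"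
  shows "homog (l *\<^sub>R (H - Z) + m *\<^sub>R Z) m \<noteq> 0 \<and>
    P = abs_projplane (homog (l *\<^sub>R (H - Z) + m *\<^sub>R Z) m)"
proof -
  obtain p where p: "p \<noteq> 0" "P = abs_projplane p" by (rule projplane_cases)
  have Im0: "Im (ctr_coord Z 1 p * cnj (cplx (H - Z))) = 0"
    using proj_join_parallel[OF p(1) homog_1_nonzero, of Z H] mem p(2)
    by (simp add: affine_pt.abs_eq)
  \<comment> \<open>\<open>s\<close> is found by orthogonal projection onto H - Z. The point is then
    (s (H - Z) + w Z : w) with w its last coordinate, and (s : w) is to be compared with (l :
    m).\<close>
  obtain s where s: "xy_part p - p $ 3 *\<^sub>R Z = s *\<^sub>R (H - Z)"
  proof
    have h: "cplx (H - Z) \<noteq> 0" using H by (simp add: cplx_eq_iff)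
    have "ctr_coord Z 1 p = of_real (Re (ctr_coord Z 1 p * cnj (cplx (H - Z))) / (cmod (cplx (H - Z)))\<^sup>2)
        * cplx (H - Z)"
    proof -
      have "of_real (Re (ctr_coord Z 1 p * cnj (cplx (H - Z)))) = ctr_coord Z 1 p * cnj (cplx (H - Z))"
        using Im0 by (simp only: complex_eq_iff complex.sel Re_complex_of_real Im_complex_of_real)
      moreover have "complex_of_real ((cmod (cplx (H - Z)))\<^sup>2) = cplx (H - Z) * cnj (cplx (H - Z))"
        by (rule complex_norm_square)
      ultimately show ?thesis using h by (simp only: of_real_divide) simp
    qed
    then show "xy_part p - p $ 3 *\<^sub>R Z =
      (Re (ctr_coord Z 1 p * cnj (cplx (H - Z))) / (cmod (cplx (H - Z)))\<^sup>2) *\<^sub>R (H - Z)"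
      unfolding cplx_eq_iff[symmetric] by (simp only: cplx_simps(3)) (simp add: ctr_coord_def)
  qed
  then have p': "p = homog (s *\<^sub>R (H - Z) + p $ 3 *\<^sub>R Z) (p $ 3)"
    by (metis diff_add_cancel homog_xy_part)
  have key: ?thesis if "k \<noteq> 0" "s = k * l" "p $ 3 = k * m" for k
  proof -
    have pk: "p = k *\<^sub>R homog (l *\<^sub>R (H - Z) + m *\<^sub>R Z) m"
      by (subst p') (simp add: that scaleR_add_right flip: homog_scaleR)
    with p(1) have "homog (l *\<^sub>R (H - Z) + m *\<^sub>R Z) m \<noteq> 0" by auto
    moreover from this have "P = abs_projplane (homog (l *\<^sub>R (H - Z) + m *\<^sub>R Z) m)"
      using abs_projplane_eq_iff[of "homog (l *\<^sub>R (H - Z) + m *\<^sub>R Z) m" p] p pk by metis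
    ultimately show ?thesis by blast
  qed
  have aff: "P = affine_pt (Z + (s / p $ 3) *\<^sub>R (H - Z))" if "p $ 3 \<noteq> 0"
  proof -
    have "p = p $ 3 *\<^sub>R homog (Z + (s / p $ 3) *\<^sub>R (H - Z)) 1"
      by (subst p') (use that in \<open>simp add: scaleR_add_right add.commute flip: homog_scaleR\<close>)
    then show ?thesis unfolding p(2) affine_pt.abs_eq
      using abs_projplane_eq_iff[OF homog_1_nonzero p(1)] by metis
  qed
  show ?thesis
  proof (cases "s = 0")
    case True
    have "p $ 3 \<noteq> 0"
    proof
      assume "p $ 3 = 0"
      with True p' have "p = homog 0 0" by simp
      with p(1) show False by (simp add: homog_eq_0_iff)
    qed
    moreover from this have "P = affine_pt Z" using aff True by simp
    then have "signed_ratio P H Z = \<infinity>" by (simp add: signed_ratio_def)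
    then have "l = 0" "m = 1" by (simp_all add: l_def m_def ratio_l_def ratio_m_def)
    ultimately show ?thesis using key[of "p $ 3"] True by simp
  next
    case False
    \<comment> \<open>The value 1 assigned to the point at infinity fits the same formula, with last
      coordinate 0.\<close>
    have "signed_ratio P H Z = ereal (1 - p $ 3 / s)"
    proof (cases "p $ 3 = 0")
      case True
      then have "at_infinity P" by (simp add: p at_infinity.abs_eq proj_eq_self)
      moreover from this have "P \<noteq> affine_pt Z"
        by (auto simp: affine_pt.abs_eq at_infinity.abs_eq proj_eq_self)
      ultimately show ?thesis by (simp add: signed_ratio_def True one_ereal_def)
    next
      case False
      then show ?thesis
        using signed_ratio_affine[OF H, of "s / p $ 3"] \<open>s \<noteq> 0\<close> by (simp add: aff)
    qed
    then have "l = 1" "m = p $ 3 / s" by (simp_all add: l_def m_def ratio_l_def ratio_m_def)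
    then show ?thesis using key[of s] False by simp
  qed
qed

section \<open>The eight points on one conic\<close>

text \<open>Here \<open>d\<close> is any complex number; the theorem takes the vertex outside the
  triangle. For m = 0 the coefficient l e2 might vanish and leave the zero form, so 1 replaces it
  and the form becomes that of the circle.\<close>

lemma isogonal_on_pencil_conic:
  fixes A B C D Z H r t
  defines "a \<equiv> unit_coord Z r A" and "b \<equiv> unit_coord Z r B" and "c \<equiv> unit_coord Z r C"
    and "l \<equiv> ratio_l t" and "m \<equiv> ratio_m t"
  assumes r: "r > 0" and circ: "dist A Z = r" "dist B Z = r" "dist C Z = r"
    and neq: "A \<noteq> B" "B \<noteq> C" "A \<noteq> C" and ne: "\<not> equilateral A B C"
    and H: "is_orthocenter A B C H" and P: "P \<in> proj_join (affine_pt Z) (affine_pt H)"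
    and t: "signed_ratio P H Z = t" and Q: "isogonal_conjugate A B C P Q"
    and e: "e1 = a + b + c + d" "e2 = a * b + a * c + a * d + b * c + b * d + c * d"
      "e3 = b * c * d + a * c * d + a * b * d + a * b * c" "e4 = a * b * c * d"
  shows "\<exists>q. q \<noteq> 0 \<and> Q = abs_projplane q \<and>
    pencil_form e1 e2 e3 e4 m (if m = 0 then 1 else l * e2) (ctr_coord Z r q) (q $ 3) = 0"
proof -
  have r0: "r \<noteq> 0" using r by simp
  have unit: "cmod a = 1" "cmod b = 1" "cmod c = 1"
    using r circ by (simp_all add: a_def b_def c_def cmod_unit_coord)
  have neqc: "a \<noteq> b" "b \<noteq> c" "a \<noteq> c"
    using neq r0 by (simp_all add: a_def b_def c_def unit_coord_eq_iff)
  have h: "cplx (H - Z) / of_real r = a + b + c"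
    using orthocenter_unit_coord[OF r circ neq H] by (simp only: a_def b_def c_def unit_coord_def)
  have s0: "a + b + c \<noteq> 0"
    using equilateral_unit_coord[OF r circ] ne by (auto simp: a_def b_def c_def)
  then have HZ: "H \<noteq> Z" using h by auto
  define p where "p = homog (l *\<^sub>R (H - Z) + m *\<^sub>R Z) m"
  have p: "p \<noteq> 0" "P = abs_projplane p"
    using euler_line_point[OF HZ P] unfolding t p_def l_def m_def by blast+
  have pc: "ctr_coord Z r p = of_real l * (a + b + c)" "p $ 3 = m"
    by (simp_all add: p_def ctr_coord_def flip: h)
  obtain q where q: "q \<noteq> 0" "Q = abs_projplane q" by (rule projplane_cases)
  let ?z = "ctr_coord Z r q" and ?w = "q $ 3"
  have "Q \<in> reflect_in_bisector A B C ` proj_join (affine_pt A) P"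
    "Q \<in> reflect_in_bisector B C A ` proj_join (affine_pt B) P"
    using Q by (simp_all add: isogonal_conjugate_def)
  then have "ctr_coord Z r p * of_real ?w + ?z * of_real (p $ 3)
      + a * b * c * cnj (ctr_coord Z r p) * cnj ?z = (a + b + c) * of_real (p $ 3 * ?w)"
    using reflect_in_bisector_unit[OF r circ neq p(1) q(1)]
      reflect_in_bisector_unit[OF r circ(2,3,1) neq(2) neq(3)[symmetric] neq(1)[symmetric] p(1) q(1)]
    unfolding p(2) q(2) a_def[symmetric] b_def[symmetric] c_def[symmetric]
    by (intro isogonal_equation[OF unit neqc])
  \<comment> \<open>Insert p = l s1 with last coordinate \<open>m\<close> and use s3 s1' =
    s2.\<close>
  then have eq: "of_real m * ?z + of_real l * (b * c + c * a + a * b) * cnj ?z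
      = of_real (m - l) * (a + b + c) * of_real ?w"
    using cnj_unit[OF unit(1)] cnj_unit[OF unit(2)] cnj_unit[OF unit(3)]
    unfolding pc complex_cnj_mult complex_cnj_add complex_cnj_complex_of_real of_real_mult of_real_diff
    by algebra
  have "pencil_form e1 e2 e3 e4 m (if m = 0 then 1 else l * e2) ?z ?w = 0"
  proof (cases "m = 0")
    case True
    then have "l = 1" by (auto simp: l_def m_def ratio_l_def ratio_m_def)
    with True eq have "?z * cnj ?z = (of_real ?w)\<^sup>2"
      by (intro isogonal_of_infinity_on_circle[OF unit s0]) simp
    with True show ?thesis by (simp add: pencil_form_def)
  next
    case False
    then show ?thesis using pencil_form_isogonal[OF unit eq] by (simp add: e)
  qed
  with q show ?thesis by blast
qed

lemma on_circle_in_order_dist: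
  assumes "r > 0" "on_circle_in_order Z r A B C D"
  shows "dist A Z = r" "dist B Z = r" "dist C Z = r" "dist D Z = r"
proof -
  have "dist (Z + r *\<^sub>R vector [cos x, sin x]) Z = r" for x
  proof -
    have "norm (vector [cos x, sin x] :: real^2) = 1"
      by (simp add: norm_vec_def L2_set_def sum_2 vector_2)
    with assms(1) show ?thesis by (simp add: dist_norm)
  qed
  then show "dist A Z = r" "dist B Z = r" "dist C Z = r" "dist D Z = r"
    using assms(2) by (auto simp: on_circle_in_order_def)
qed

theorem theorem2p5:
  fixes A B C D Z H\<^sub>A H\<^sub>B H\<^sub>C H\<^sub>D :: "real^2" and r :: real
    and P\<^sub>A P\<^sub>B P\<^sub>C P\<^sub>D Q\<^sub>A Q\<^sub>B Q\<^sub>C Q\<^sub>D :: projplane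
  assumes "r > 0" and "distinct [A, B, C, D]" and "on_circle_in_order Z r A B C D"
    and "\<not> equilateral A B C" and "\<not> equilateral A B D"
    and "\<not> equilateral A C D" and "\<not> equilateral B C D"
    and "is_orthocenter A B C H\<^sub>D" and "is_orthocenter A C D H\<^sub>B"
    and "is_orthocenter A B D H\<^sub>C" and "is_orthocenter B C D H\<^sub>A"
    and "P\<^sub>D \<in> proj_join (affine_pt Z) (affine_pt H\<^sub>D)"
    and "P\<^sub>A \<in> proj_join (affine_pt Z) (affine_pt H\<^sub>A)"
    and "signed_ratio P\<^sub>A H\<^sub>A Z = signed_ratio P\<^sub>D H\<^sub>D Z"
    and "P\<^sub>B \<in> proj_join (affine_pt Z) (affine_pt H\<^sub>B)"
    and "signed_ratio P\<^sub>B H\<^sub>B Z = signed_ratio P\<^sub>D H\<^sub>D Z"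
    and "P\<^sub>C \<in> proj_join (affine_pt Z) (affine_pt H\<^sub>C)"
    and "signed_ratio P\<^sub>C H\<^sub>C Z = signed_ratio P\<^sub>D H\<^sub>D Z"
    and "isogonal_conjugate A B C P\<^sub>D Q\<^sub>D" and "isogonal_conjugate B C D P\<^sub>A Q\<^sub>A"
    and "isogonal_conjugate A C D P\<^sub>B Q\<^sub>B" and "isogonal_conjugate A B D P\<^sub>C Q\<^sub>C"
  shows "\<exists>S. is_conic S \<and>
    {affine_pt A, affine_pt B, affine_pt C, affine_pt D, Q\<^sub>A, Q\<^sub>B, Q\<^sub>C, Q\<^sub>D} \<subseteq> S"
proof -
  define t where "t = signed_ratio P\<^sub>D H\<^sub>D Z"
  define a where "a = unit_coord Z r A"
  define b where "b = unit_coord Z r B"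
  define c where "c = unit_coord Z r C"
  define d where "d = unit_coord Z r D"
  \<comment> \<open>The coefficients are symmetric in the four vertices and the weights depend only
    on the common ratio \<open>t\<close>, so all four triangles lead to the same form.\<close>
  define e1 where "e1 = a + b + c + d"
  define e2 where "e2 = a * b + a * c + a * d + b * c + b * d + c * d"
  define e3 where "e3 = b * c * d + a * c * d + a * b * d + a * b * c"
  define e4 where "e4 = a * b * c * d"
  define m where "m = ratio_m t"
  define k where "k = (if m = 0 then 1 else ratio_l t * e2)"
  note circ = on_circle_in_order_dist[OF assms(1,3)]
  note iso = isogonal_on_pencil_conic[OF \<open>r > 0\<close>, where t = t and Z = Z, folded a_def b_def c_def d_def m_def]
  have vertex: "\<exists>q. q \<noteq> 0 \<and> affine_pt X = abs_projplane q \<and>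
      pencil_form e1 e2 e3 e4 m k (ctr_coord Z r q) (q $ 3) = 0" if "X \<in> {A, B, C, D}" for X
  proof (intro exI conjI)
    have unit: "cmod a = 1" "cmod b = 1" "cmod c = 1" "cmod d = 1"
      using \<open>r > 0\<close> circ by (simp_all add: a_def b_def c_def d_def cmod_unit_coord)
    have "pencil_form e1 e2 e3 e4 m k x 1 = 0" if "x \<in> {a, b, c, d}" for x
      using that pencil_form_vertex[OF unit(1), of b c d m k] pencil_form_vertex[OF unit(2), of a c d m k]
        pencil_form_vertex[OF unit(3), of a b d m k] pencil_form_vertex[OF unit(4), of a b c m k]
      by (auto simp: e1_def e2_def e3_def e4_def ac_simps)
    moreover have "unit_coord Z r X \<in> {a, b, c, d}"
      using that by (auto simp: a_def b_def c_def d_def)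
    ultimately show "pencil_form e1 e2 e3 e4 m k (ctr_coord Z r (homog X 1)) (homog X 1 $ 3) = 0"
      by (simp add: unit_coord_def)
  qed (simp_all add: affine_pt.abs_eq)
  \<comment> \<open>In this and the next three facts \<open>d\<close> becomes the vertex left out of
    the triangle; reordering sums and products identifies the symmetric functions.\<close>
  have QD: "\<exists>q. q \<noteq> 0 \<and> Q\<^sub>D = abs_projplane q \<and>
      pencil_form e1 e2 e3 e4 m k (ctr_coord Z r q) (q $ 3) = 0"
    unfolding k_def using assms circ
    by (intro iso[where A = A and B = B and C = C and d = d])
      (auto simp: t_def a_def b_def c_def d_def e1_def e2_def e3_def e4_def algebra_simps)
  have QA: "\<exists>q. q \<noteq> 0 \<and> Q\<^sub>A = abs_projplane q \<and>
      pencil_form e1 e2 e3 e4 m k (ctr_coord Z r q) (q $ 3) = 0"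
    unfolding k_def using assms circ
    by (intro iso[where A = B and B = C and C = D and d = a])
      (auto simp: t_def a_def b_def c_def d_def e1_def e2_def e3_def e4_def algebra_simps)
  have QB: "\<exists>q. q \<noteq> 0 \<and> Q\<^sub>B = abs_projplane q \<and>
      pencil_form e1 e2 e3 e4 m k (ctr_coord Z r q) (q $ 3) = 0"
    unfolding k_def using assms circ
    by (intro iso[where A = A and B = C and C = D and d = b])
      (auto simp: t_def a_def b_def c_def d_def e1_def e2_def e3_def e4_def algebra_simps)
  have QC: "\<exists>q. q \<noteq> 0 \<and> Q\<^sub>C = abs_projplane q \<and>
      pencil_form e1 e2 e3 e4 m k (ctr_coord Z r q) (q $ 3) = 0"
    unfolding k_def using assms circ
    by (intro iso[where A = A and B = B and C = D and d = c])
      (auto simp: t_def a_def b_def c_def d_def e1_def e2_def e3_def e4_def algebra_simps)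
  show ?thesis
  proof (rule pencil_form_in_conic[where Z = Z and r = r])
    show "of_real m \<noteq> (0::complex) \<or> k \<noteq> 0" by (simp add: k_def)
  qed (use assms(1) vertex QA QB QC QD in auto)
qed

end
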